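(* Let $(\mathbf{A},\Box,\Diamond)$ be any finite Fischer Servi GAO. Then $$(\mathbf{A},\Box,\Diamond)\cong(\mathbf{G}(\mathbf{F}_{\mathbf{A}}),\beta_{(\geq\circ R_{\mathbf{A}})},\delta_{R_{\mathbf{A}}})$$ via the isomorphism $r:A\to G(\mathbf{F}_{\mathbf{A}})$, $r(a)=\{f\in F_{\mathbf{A}}\mid a\in f\}$.
   Context: A G\"odel algebra is a Heyting algebra $\mathbf{A}=(A,\wedge,\vee,\to,\bot,\top)$ satisfying prelinearity $(a\to b)\vee(b\to a)=\top$. A GAO (G\"odel algebra with operators) is a triple $(\mathbf{A},\Box,\Diamond)$ with $\mathbf{A}$ a G\"odel algebra and $\Box,\Diamond:A\to A$ satisfying $\Box\top=\top$, $\Box(x\wedge y)=\Box x\wedge\Box y$, $\Diamond\bot=\bot$, $\Diamond(x\vee y)=\Diamond x\vee\Diamond y$. A Fischer Servi GAO is a GAO satisfying, for all $a,b$: $\Diamond(a\to b)\leq(\Box a\to\Diamond b)$ and $(\Diamond a\to\Box b)\leq\Box(a\to b)$. A forest is a finite poset in which the downset of each element is totally ordered. For a finite G\"odel algebra $\mathbf{A}$, $F_{\mathbf{A}}$ is the set of its prime (proper) filters, ordered by $f_1\leq f_2$ iff $f_1\supseteq f_2$; $\mathbf{F}_{\mathbf{A}}=(F_{\mathbf{A}},\leq)$ is a finite forest. For a finite forest $\mathbf{F}=(F,\leq)$, $G(\mathbf{F})$ is the set of all downward closed subsets of $F$, and $\mathbf{G}(\mathbf{F})=(G(\mathbf{F}),\cap,\cup,\to,\emptyset,F)$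 with $x\to y=F\setminus{\uparrow}(x\setminus y)$, which is a G\"odel algebra. On $F_{\mathbf{A}}$ define: $f_1R_\Box f_2$ iff $\Box^{-1}(f_1)\subseteq f_2$; $f_1R_\Diamond f_2$ iff $f_2\subseteq\Diamond^{-1}(f_1)$; and $R_{\mathbf{A}}=R_\Box\cap R_\Diamond$. Composition of relations: $x(S\circ T)y$ iff there is $z$ with $xSz$ and $zTy$; so $f(\geq\circ R_{\mathbf{A}})g$ iff there is $h\leq f$ with $hR_{\mathbf{A}}g$. For $a\in G(\mathbf{F}_{\mathbf{A}})$ and a relation $S$ on $F_{\mathbf{A}}$ let $\beta_S(a)=\{y\in F_{\mathbf{A}}\mid\forall z\in F_{\mathbf{A}},\ (ySz\Rightarrow z\in a)\}$ and $\delta_S(a)=\{y\in F_{\mathbf{A}}\mid\exists z\in a,\ ySz\}$. *)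

theory Defs
  imports "HOL-Algebra.Congruence"
begin

record 'a heyting = "'a partial_object" +
  meet :: "'a \<Rightarrow> 'a \<Rightarrow> 'a" (infixl \<open>\<sqinter>\<index>\<close> 70)
  join :: "'a \<Rightarrow> 'a \<Rightarrow> 'a" (infixl \<open>\<squnion>\<index>\<close> 65)
  imp :: "'a \<Rightarrow> 'a \<Rightarrow> 'a" (infixr \<open>\<leadsto>\<index>\<close> 60)
  bottom :: 'a (\<open>\<bottom>\<index>\<close>)
  top :: 'a (\<open>\<top>\<index>\<close>)

record 'a gao = "'a heyting" +
  Box :: "'a \<Rightarrow> 'a" (\<open>\<box>\<index> _\<close> [81] 80)
  Dia :: "'a \<Rightarrow> 'a" (\<open>\<diamond>\<index> _\<close> [81] 80)

definition le :: "('a, 'm) heyting_scheme \<Rightarrow> 'a \<Rightarrow> 'a \<Rightarrow> bool" (infix \<open>\<sqsubseteq>\<index>\<close> 50)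
  where "x \<sqsubseteq>\<^bsub>A\<^esub> y \<longleftrightarrow> x \<sqinter>\<^bsub>A\<^esub> y = x"

locale heyting_algebra =
  fixes A :: "('a, 'm) heyting_scheme" (structure)
  assumes meet_closed: "\<lbrakk>x \<in> carrier A; y \<in> carrier A\<rbrakk> \<Longrightarrow> x \<sqinter> y \<in> carrier A"
    and join_closed: "\<lbrakk>x \<in> carrier A; y \<in> carrier A\<rbrakk> \<Longrightarrow> x \<squnion> y \<in> carrier A"
    and imp_closed: "\<lbrakk>x \<in> carrier A; y \<in> carrier A\<rbrakk> \<Longrightarrow> (x \<leadsto> y) \<in> carrier A"
    and bottom_closed: "\<bottom> \<in> carrier A"
    and top_closed: "\<top> \<in> carrier A"
    and meet_assoc: "\<lbrakk>x \<in> carrier A; y \<in> carrier A; z \<in> carrier A\<rbrakk>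
      \<Longrightarrow> (x \<sqinter> y) \<sqinter> z = x \<sqinter> (y \<sqinter> z)"
    and join_assoc: "\<lbrakk>x \<in> carrier A; y \<in> carrier A; z \<in> carrier A\<rbrakk>
      \<Longrightarrow> (x \<squnion> y) \<squnion> z = x \<squnion> (y \<squnion> z)"
    and meet_comm: "\<lbrakk>x \<in> carrier A; y \<in> carrier A\<rbrakk> \<Longrightarrow> x \<sqinter> y = y \<sqinter> x"
    and join_comm: "\<lbrakk>x \<in> carrier A; y \<in> carrier A\<rbrakk> \<Longrightarrow> x \<squnion> y = y \<squnion> x"
    and meet_join_absorb: "\<lbrakk>x \<in> carrier A; y \<in> carrier A\<rbrakk> \<Longrightarrow> x \<sqinter> (x \<squnion> y) = x"
    and join_meet_absorb: "\<lbrakk>x \<in> carrier A; y \<in> carrier A\<rbrakk> \<Longrightarrow> x \<squnion> (x \<sqinter> y) = x"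
    and bottom_least: "x \<in> carrier A \<Longrightarrow> \<bottom> \<sqsubseteq> x"
    and top_greatest: "x \<in> carrier A \<Longrightarrow> x \<sqsubseteq> \<top>"
    and residuation: "\<lbrakk>x \<in> carrier A; y \<in> carrier A; z \<in> carrier A\<rbrakk>
      \<Longrightarrow> z \<sqinter> x \<sqsubseteq> y \<longleftrightarrow> z \<sqsubseteq> (x \<leadsto> y)"

locale godel_algebra = heyting_algebra +
  assumes prelinearity: "\<lbrakk>x \<in> carrier A; y \<in> carrier A\<rbrakk>
    \<Longrightarrow> (x \<leadsto> y) \<squnion> (y \<leadsto> x) = \<top>"

locale gao = godel_algebra A for A :: "('a, 'm) gao_scheme" (structure) +
  assumes Box_closed: "x \<in> carrier A \<Longrightarrow> \<box> x \<in> carrier A"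
    and Dia_closed: "x \<in> carrier A \<Longrightarrow> \<diamond> x \<in> carrier A"
    and Box_top: "\<box> \<top> = \<top>"
    and Box_meet: "\<lbrakk>x \<in> carrier A; y \<in> carrier A\<rbrakk> \<Longrightarrow> \<box> (x \<sqinter> y) = \<box> x \<sqinter> \<box> y"
    and Dia_bottom: "\<diamond> \<bottom> = \<bottom>"
    and Dia_join: "\<lbrakk>x \<in> carrier A; y \<in> carrier A\<rbrakk> \<Longrightarrow> \<diamond> (x \<squnion> y) = \<diamond> x \<squnion> \<diamond> y"

locale fischer_servi_gao = gao +
  assumes FS1: "\<lbrakk>x \<in> carrier A; y \<in> carrier A\<rbrakk> \<Longrightarrow> \<diamond> (x \<leadsto> y) \<sqsubseteq> (\<box> x \<leadsto> \<diamond> y)"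
    and FS2: "\<lbrakk>x \<in> carrier A; y \<in> carrier A\<rbrakk> \<Longrightarrow> (\<diamond> x \<leadsto> \<box> y) \<sqsubseteq> \<box> (x \<leadsto> y)"

text \<open>A bijective homomorphism. Closure of the carrier of \<open>B\<close> under the operations of \<open>B\<close>
  follows when \<open>A\<close> is closed under its own.\<close>

definition gao_iso ::
    "('a \<Rightarrow> 'b) \<Rightarrow> ('a, 'm) gao_scheme \<Rightarrow> ('b, 'n) gao_scheme \<Rightarrow> bool" where
  "gao_iso h A B \<longleftrightarrow>
     bij_betw h (carrier A) (carrier B) \<and>
     (\<forall>x \<in> carrier A. \<forall>y \<in> carrier A.
        h (x \<sqinter>\<^bsub>A\<^esub> y) = h x \<sqinter>\<^bsub>B\<^esub> h y \<and>
        h (x \<squnion>\<^bsub>A\<^esub> y) = h x \<squnion>\<^bsub>B\<^esub> h y \<and>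
        h (x \<leadsto>\<^bsub>A\<^esub> y) = (h x \<leadsto>\<^bsub>B\<^esub> h y)) \<and>
     h \<bottom>\<^bsub>A\<^esub> = \<bottom>\<^bsub>B\<^esub> \<and>
     h \<top>\<^bsub>A\<^esub> = \<top>\<^bsub>B\<^esub> \<and>
     (\<forall>x \<in> carrier A. h (\<box>\<^bsub>A\<^esub> x) = \<box>\<^bsub>B\<^esub> (h x) \<and> h (\<diamond>\<^bsub>A\<^esub> x) = \<diamond>\<^bsub>B\<^esub> (h x))"

text \<open>A poset is given by its carrier \<open>F\<close> and its order \<open>L \<subseteq> F \<times> F\<close>, where \<open>(x, y) \<in> L\<close>
  means \<open>x \<le> y\<close>. Thus \<open>L `` X\<close> is the upset generated by \<open>X \<subseteq> F\<close>.\<close>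

definition downsets :: "'p set \<Rightarrow> 'p rel \<Rightarrow> 'p set set" where
  "downsets F L = {a. a \<subseteq> F \<and> (\<forall>y \<in> a. \<forall>x. (x, y) \<in> L \<longrightarrow> x \<in> a)}"

definition downset_algebra :: "'p set \<Rightarrow> 'p rel \<Rightarrow> 'p set heyting" where
  "downset_algebra F L =
     \<lparr>carrier = downsets F L,
      meet = (\<inter>),
      join = (\<union>),
      imp = (\<lambda>x y. F - L `` (x - y)),
      bottom = {},
      top = F\<rparr>"

definition beta :: "'p set \<Rightarrow> 'p rel \<Rightarrow> 'p set \<Rightarrow> 'p set" where
  "beta F S a = {y \<in> F. \<forall>z \<in> F. (y, z) \<in> S \<longrightarrow> z \<in> a}"

definition delta :: "'p set \<Rightarrow> 'p rel \<Rightarrow> 'p set \<Rightarrow> 'p set" where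
  "delta F S a = {y \<in> F. \<exists>z \<in> a. (y, z) \<in> S}"

definition with_operators :: "'a heyting \<Rightarrow> ('a \<Rightarrow> 'a) \<Rightarrow> ('a \<Rightarrow> 'a) \<Rightarrow> 'a gao" where
  "with_operators A b d = heyting.extend A (gao.fields b d)"

definition is_filter :: "('a, 'm) heyting_scheme \<Rightarrow> 'a set \<Rightarrow> bool" where
  "is_filter A f \<longleftrightarrow>
     f \<subseteq> carrier A \<and> f \<noteq> {} \<and>
     (\<forall>x \<in> f. \<forall>y \<in> f. x \<sqinter>\<^bsub>A\<^esub> y \<in> f) \<and>
     (\<forall>x \<in> f. \<forall>y \<in> carrier A. x \<sqsubseteq>\<^bsub>A\<^esub> y \<longrightarrow> y \<in> f)"

definition prime_filters :: "('a, 'm) heyting_scheme \<Rightarrow> 'a set set" where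
  "prime_filters A =
     {f. is_filter A f \<and> f \<noteq> carrier A \<and>
         (\<forall>x \<in> carrier A. \<forall>y \<in> carrier A. x \<squnion>\<^bsub>A\<^esub> y \<in> f \<longrightarrow> x \<in> f \<or> y \<in> f)}"

text \<open>Prime filters are ordered by reverse inclusion.\<close>

definition filter_order :: "('a, 'm) heyting_scheme \<Rightarrow> 'a set rel" where
  "filter_order A = {(f, g). f \<in> prime_filters A \<and> g \<in> prime_filters A \<and> f \<supseteq> g}"

definition R_Box :: "('a, 'm) gao_scheme \<Rightarrow> 'a set rel" where
  "R_Box A = {(f, g). f \<in> prime_filters A \<and> g \<in> prime_filters A \<and>
                {x \<in> carrier A. \<box>\<^bsub>A\<^esub> x \<in> f} \<subseteq> g}"

definition R_Dia :: "('a, 'm) gao_scheme \<Rightarrow> 'a set rel" where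
  "R_Dia A = {(f, g). f \<in> prime_filters A \<and> g \<in> prime_filters A \<and>
                g \<subseteq> {x \<in> carrier A. \<diamond>\<^bsub>A\<^esub> x \<in> f}}"

definition R_rel :: "('a, 'm) gao_scheme \<Rightarrow> 'a set rel" where
  "R_rel A = R_Box A \<inter> R_Dia A"

definition r_map :: "('a, 'm) heyting_scheme \<Rightarrow> 'a \<Rightarrow> 'a set set" where
  "r_map A a = {f \<in> prime_filters A. a \<in> f}"

end

(* The map r is the Priestley/Birkhoff representation of a finite distributive lattice; everything
  rests on separating a filter from an ideal by a prime filter.

  For the diamond, given dia a in f, separate the filter generated by a and the inverse image of f
  under box from the ideal of all c with dia c not in f; FS1 says exactly that the two are disjoint.

  For the box, given box a not in f, first separate the inverse image of f under box from a by a
  prime filter g, and then the filter generated by f and dia g from the ideal generated by the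
  box c with c not in g; FS2 says that these are disjoint. The resulting prime filter h satisfies
  h <= f and h R g. *)

theory Submission
  imports Defs
begin

section \<open>Order and lattice calculus of Heyting algebras\<close>

context heyting_algebra
begin

text \<open>Idempotence is not among the axioms; it follows from the two absorption laws, applied to
  \<open>x\<close> and \<open>x \<squnion> (x \<sqinter> x)\<close>.\<close>

lemma meet_idem: "x \<in> carrier A \<Longrightarrow> x \<sqinter> x = x"
  by (metis meet_join_absorb join_meet_absorb meet_closed)

lemma le_refl: "x \<in> carrier A \<Longrightarrow> x \<sqsubseteq> x"
  by (simp add: le_def meet_idem)

lemma le_trans:
  "\<lbrakk>x \<sqsubseteq> y; y \<sqsubseteq> z; x \<in> carrier A; y \<in> carrier A; z \<in> carrier A\<rbrakk> \<Longrightarrow> x \<sqsubseteq> z"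
  unfolding le_def by (metis meet_assoc)

lemma le_antisym: "\<lbrakk>x \<sqsubseteq> y; y \<sqsubseteq> x; x \<in> carrier A; y \<in> carrier A\<rbrakk> \<Longrightarrow> x = y"
  unfolding le_def by (metis meet_comm)

lemma meet_le1: "\<lbrakk>x \<in> carrier A; y \<in> carrier A\<rbrakk> \<Longrightarrow> x \<sqinter> y \<sqsubseteq> x"
  unfolding le_def by (metis meet_assoc meet_comm meet_idem meet_closed)

lemma meet_le2: "\<lbrakk>x \<in> carrier A; y \<in> carrier A\<rbrakk> \<Longrightarrow> x \<sqinter> y \<sqsubseteq> y"
  unfolding le_def by (metis meet_assoc meet_idem)

lemma meet_greatest:
  "\<lbrakk>z \<sqsubseteq> x; z \<sqsubseteq> y; x \<in> carrier A; y \<in> carrier A; z \<in> carrier A\<rbrakk> \<Longrightarrow> z \<sqsubseteq> x \<sqinter> y"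
  unfolding le_def by (metis meet_assoc)

lemma meet_mono:
  assumes "x \<sqsubseteq> x'" "y \<sqsubseteq> y'"
    and "x \<in> carrier A" "y \<in> carrier A" "x' \<in> carrier A" "y' \<in> carrier A"
  shows "x \<sqinter> y \<sqsubseteq> x' \<sqinter> y'"
  using assms by (meson le_trans meet_closed meet_greatest meet_le1 meet_le2)

lemma le_iff_join: "\<lbrakk>x \<in> carrier A; y \<in> carrier A\<rbrakk> \<Longrightarrow> x \<sqsubseteq> y \<longleftrightarrow> x \<squnion> y = y"
  unfolding le_def by (metis meet_join_absorb join_meet_absorb meet_comm join_comm)

lemma join_ge1: "\<lbrakk>x \<in> carrier A; y \<in> carrier A\<rbrakk> \<Longrightarrow> x \<sqsubseteq> x \<squnion> y"
  by (simp add: le_def meet_join_absorb)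

lemma join_ge2: "\<lbrakk>x \<in> carrier A; y \<in> carrier A\<rbrakk> \<Longrightarrow> y \<sqsubseteq> x \<squnion> y"
  by (metis join_ge1 join_comm)

lemma join_least:
  "\<lbrakk>x \<sqsubseteq> z; y \<sqsubseteq> z; x \<in> carrier A; y \<in> carrier A; z \<in> carrier A\<rbrakk> \<Longrightarrow> x \<squnion> y \<sqsubseteq> z"
  by (simp add: le_iff_join join_assoc join_closed)

lemma meet_imp_le: "\<lbrakk>x \<in> carrier A; y \<in> carrier A\<rbrakk> \<Longrightarrow> (x \<leadsto> y) \<sqinter> x \<sqsubseteq> y"
  using residuation[of x y "x \<leadsto> y"] by (simp add: imp_closed le_refl)

section \<open>Elementary properties of filters and prime filters\<close>

lemma filter_closed: "\<lbrakk>is_filter A f; x \<in> f\<rbrakk> \<Longrightarrow> x \<in> carrier A"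
  by (auto simp: is_filter_def)

lemma filter_meet: "\<lbrakk>is_filter A f; x \<in> f; y \<in> f\<rbrakk> \<Longrightarrow> x \<sqinter> y \<in> f"
  by (auto simp: is_filter_def)

lemma filter_up: "\<lbrakk>is_filter A f; x \<in> f; x \<sqsubseteq> y; y \<in> carrier A\<rbrakk> \<Longrightarrow> y \<in> f"
  by (auto simp: is_filter_def)

lemma filter_top: "is_filter A f \<Longrightarrow> \<top> \<in> f"
proof -
  assume f: "is_filter A f"
  then obtain x where "x \<in> f" by (auto simp: is_filter_def)
  then show "\<top> \<in> f"
    using filter_up[OF f] filter_closed[OF f] top_closed top_greatest by blast
qed

lemma filter_mp: "\<lbrakk>is_filter A f; x \<leadsto> y \<in> f; x \<in> f; y \<in> carrier A\<rbrakk> \<Longrightarrow> y \<in> f"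
  by (meson filter_closed filter_meet filter_up meet_imp_le)

lemma prime_filter_is_filter: "f \<in> prime_filters A \<Longrightarrow> is_filter A f"
  by (simp add: prime_filters_def)

lemma prime_filter_bottom: "f \<in> prime_filters A \<Longrightarrow> \<bottom> \<notin> f"
proof
  assume f: "f \<in> prime_filters A" and "\<bottom> \<in> f"
  then have "carrier A \<subseteq> f"
    using filter_up[OF prime_filter_is_filter[OF f]] bottom_least by blast
  then show False using f by (auto simp: prime_filters_def is_filter_def)
qed

lemma prime_filter_join:
  assumes "f \<in> prime_filters A" "x \<in> carrier A" "y \<in> carrier A"
  shows "x \<squnion> y \<in> f \<longleftrightarrow> x \<in> f \<or> y \<in> f"
proof
  show "x \<squnion> y \<in> f \<Longrightarrow> x \<in> f \<or> y \<in> f"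
    using assms by (simp add: prime_filters_def)
  show "x \<in> f \<or> y \<in> f \<Longrightarrow> x \<squnion> y \<in> f"
    using assms filter_up[OF prime_filter_is_filter[OF assms(1)]] join_ge1 join_ge2 join_closed
    by metis
qed

section \<open>Generated filters and separation by prime filters\<close>

lemma is_filter_top: "is_filter A {\<top>}"
  using le_antisym[OF _ top_greatest] by (auto simp: is_filter_def top_closed meet_idem)

text \<open>For a filter \<open>f\<close> and a nonempty down-directed \<open>B\<close>, this is the
  filter generated by \<open>f \<union> B\<close>: directedness lets a single \<open>b\<close> stand
  in for finite meets of elements of \<open>B\<close>.\<close>

definition adjoin :: "'a set \<Rightarrow> 'a set \<Rightarrow> 'a set"
  where "adjoin f B = {z \<in> carrier A. \<exists>d \<in> f. \<exists>b \<in> B. d \<sqinter> b \<sqsubseteq> z}"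

lemma is_filter_adjoin:
  assumes f: "is_filter A f" and B: "B \<subseteq> carrier A" "B \<noteq> {}"
    and directed: "\<And>b b'. \<lbrakk>b \<in> B; b' \<in> B\<rbrakk> \<Longrightarrow> \<exists>c \<in> B. c \<sqsubseteq> b \<and> c \<sqsubseteq> b'"
  shows "is_filter A (adjoin f B)"
  unfolding is_filter_def
proof (intro conjI ballI impI)
  show "adjoin f B \<subseteq> carrier A" by (auto simp: adjoin_def)
  show "adjoin f B \<noteq> {}"
  proof -
    obtain b where "b \<in> B" using B(2) by blast
    then have "\<top> \<in> adjoin f B"
      using filter_top[OF f] B(1) top_greatest[OF meet_closed] top_closed
      unfolding adjoin_def by blast
    then show ?thesis by blast
  qed
next
  fix x y assume "x \<in> adjoin f B" "y \<in> adjoin f B"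
  then obtain d b d' b' where db: "d \<in> f" "b \<in> B" "d \<sqinter> b \<sqsubseteq> x" "d' \<in> f" "b' \<in> B" "d' \<sqinter> b' \<sqsubseteq> y"
    and xy: "x \<in> carrier A" "y \<in> carrier A"
    by (auto simp: adjoin_def)
  obtain c where c: "c \<in> B" "c \<sqsubseteq> b" "c \<sqsubseteq> b'" using directed db by blast
  have mem: "d \<in> carrier A" "d' \<in> carrier A" "b \<in> carrier A" "b' \<in> carrier A" "c \<in> carrier A"
    using db c B filter_closed[OF f] by auto
  have "(d \<sqinter> d') \<sqinter> c \<sqsubseteq> x"
    by (rule le_trans[OF meet_mono[OF meet_le1 c(2)] db(3)]) (auto simp: mem xy meet_closed)
  moreover have "(d \<sqinter> d') \<sqinter> c \<sqsubseteq> y"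
    by (rule le_trans[OF meet_mono[OF meet_le2 c(3)] db(6)]) (auto simp: mem xy meet_closed)
  ultimately have "(d \<sqinter> d') \<sqinter> c \<sqsubseteq> x \<sqinter> y"
    by (simp add: meet_greatest mem xy meet_closed)
  then show "x \<sqinter> y \<in> adjoin f B"
    using c filter_meet[OF f] db xy by (auto simp: adjoin_def meet_closed)
next
  fix x y assume "x \<in> adjoin f B" "y \<in> carrier A" "x \<sqsubseteq> y"
  then obtain d b where db: "d \<in> f" "b \<in> B" "d \<sqinter> b \<sqsubseteq> x" and x: "x \<in> carrier A"
    by (auto simp: adjoin_def)
  have "d \<in> carrier A" "b \<in> carrier A" using db B filter_closed[OF f] by auto
  then have "d \<sqinter> b \<sqsubseteq> y"
    using le_trans[OF db(3) \<open>x \<sqsubseteq> y\<close>] x \<open>y \<in> carrier A\<close> meet_closed by blast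
  then show "y \<in> adjoin f B"
    using db \<open>y \<in> carrier A\<close> by (auto simp: adjoin_def)
qed

lemma adjoin_superset1: "\<lbrakk>is_filter A f; B \<subseteq> carrier A; B \<noteq> {}\<rbrakk> \<Longrightarrow> f \<subseteq> adjoin f B"
  using filter_closed meet_le1 unfolding adjoin_def by blast

lemma adjoin_superset2: "\<lbrakk>is_filter A f; B \<subseteq> carrier A\<rbrakk> \<Longrightarrow> B \<subseteq> adjoin f B"
  using filter_top filter_closed meet_le2 unfolding adjoin_def by blast

text \<open>Supplies the upper bounds for Zorn's lemma. Any two elements of the union already lie in
  a common member of the chain, so their meet does too.\<close>

lemma is_filter_chain_Union:
  assumes "C \<noteq> {}" "subset.chain {f. is_filter A f} C"
  shows "is_filter A (\<Union>C)"
proof -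
  have filt: "is_filter A f" if "f \<in> C" for f
    using that assms(2) by (auto simp: subset.chain_def)
  have lin: "f \<subseteq> g \<or> g \<subseteq> f" if "f \<in> C" "g \<in> C" for f g
    using that assms(2) by (auto simp: subset.chain_def)
  have "x \<sqinter> y \<in> \<Union>C" if "x \<in> \<Union>C" "y \<in> \<Union>C" for x y
  proof -
    from that obtain f g where fg: "f \<in> C" "x \<in> f" "g \<in> C" "y \<in> g" by blast
    then show ?thesis
      using lin[of f g] filter_meet[OF filt, of f x y] filter_meet[OF filt, of g x y] by blast
  qed
  moreover have "\<Union>C \<noteq> {}"
    using assms(1) filt filter_top by blast
  moreover have "\<Union>C \<subseteq> carrier A"
    using filt filter_closed by blast
  moreover have "y \<in> \<Union>C" if "x \<in> \<Union>C" "y \<in> carrier A" "x \<sqsubseteq> y" for x y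
    using that filt filter_up by blast
  ultimately show ?thesis
    unfolding is_filter_def by blast
qed

text \<open>A filter that is maximal among those extending \<open>f\<close> and missing
  \<open>I\<close> is prime. The up-directed set \<open>I\<close> stands for the ideal it generates:
  a filter misses one exactly when it misses the other. Since \<open>I\<close> is nonempty, the
  maximal filter is proper.\<close>

lemma prime_filter_exists:
  assumes f: "is_filter A f"
    and I: "I \<subseteq> carrier A" "I \<noteq> {}"
    and directed: "\<And>i j. \<lbrakk>i \<in> I; j \<in> I\<rbrakk> \<Longrightarrow> \<exists>k \<in> I. i \<sqsubseteq> k \<and> j \<sqsubseteq> k"
    and disj: "f \<inter> I = {}"
  shows "\<exists>g \<in> prime_filters A. f \<subseteq> g \<and> g \<inter> I = {}"
proof -
  let ?S = "{g. is_filter A g \<and> f \<subseteq> g \<and> g \<inter> I = {}}"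
  have "\<exists>M \<in> ?S. \<forall>X \<in> ?S. M \<subseteq> X \<longrightarrow> X = M"
  proof (rule subset_Zorn_nonempty)
    show "?S \<noteq> {}" using f disj by blast
  next
    fix C assume C: "C \<noteq> {}" "subset.chain ?S C"
    then have "subset.chain {f. is_filter A f} C"
      by (auto simp: subset.chain_def)
    then have "is_filter A (\<Union>C)" using C(1) by (rule is_filter_chain_Union[rotated])
    moreover have "f \<subseteq> \<Union>C" "\<Union>C \<inter> I = {}"
      using C unfolding subset.chain_def by blast+
    ultimately show "\<Union>C \<in> ?S" by blast
  qed
  then obtain g where g: "is_filter A g" "f \<subseteq> g" "g \<inter> I = {}"
    and max: "\<And>X. \<lbrakk>is_filter A X; g \<subseteq> X; X \<inter> I = {}\<rbrakk> \<Longrightarrow> X = g"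
    by (smt (verit) mem_Collect_eq subset_trans)
  \<comment> \<open>By maximality, the strictly larger filter generated by \<open>g\<close> and
    \<open>x\<close> must meet \<open>I\<close>.\<close>
  have meets: "\<exists>u \<in> g. \<exists>i \<in> I. u \<sqinter> x \<sqsubseteq> i" if x: "x \<in> carrier A" "x \<notin> g" for x
  proof (rule ccontr)
    assume "\<not> ?thesis"
    then have "adjoin g {x} \<inter> I = {}" by (auto simp: adjoin_def)
    moreover have "is_filter A (adjoin g {x})"
      by (rule is_filter_adjoin) (use g x le_refl in auto)
    moreover have "g \<subseteq> adjoin g {x}" "x \<in> adjoin g {x}"
      using adjoin_superset1[of g "{x}"] adjoin_superset2[of g "{x}"] g x by auto
    ultimately show False using max x by blast
  qed
  have "x \<in> g \<or> y \<in> g" if xy: "x \<in> carrier A" "y \<in> carrier A" "x \<squnion> y \<in> g" for x y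
  proof (rule ccontr)
    assume "\<not> ?thesis"
    then obtain u v i j where uv: "u \<in> g" "v \<in> g" "i \<in> I" "j \<in> I" "u \<sqinter> x \<sqsubseteq> i" "v \<sqinter> y \<sqsubseteq> j"
      using meets xy by metis
    obtain k where k: "k \<in> I" "i \<sqsubseteq> k" "j \<sqsubseteq> k" using directed uv by blast
    have mem: "u \<in> carrier A" "v \<in> carrier A" "i \<in> carrier A" "j \<in> carrier A" "k \<in> carrier A"
      using uv k I filter_closed[OF g(1)] by auto
    let ?w = "u \<sqinter> v"
    have w: "?w \<in> carrier A" "?w \<in> g" using mem uv g filter_meet meet_closed by auto
    have "?w \<sqinter> x \<sqsubseteq> u \<sqinter> x" "?w \<sqinter> y \<sqsubseteq> v \<sqinter> y"
      by (auto intro!: meet_mono simp: mem xy meet_closed meet_le1 meet_le2 le_refl)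
    then have "?w \<sqinter> x \<sqsubseteq> k" "?w \<sqinter> y \<sqsubseteq> k"
      using uv k mem xy w by (meson le_trans meet_closed)+
    \<comment> \<open>Residuation does the work of distributivity: \<open>x\<close> and
      \<open>y\<close>, hence also \<open>x \<squnion> y\<close>, lie below
      \<open>?w \<leadsto> k\<close>, and modus ponens in \<open>g\<close> then yields
      \<open>k \<in> g\<close>.\<close>
    then have "x \<sqsubseteq> (?w \<leadsto> k)" "y \<sqsubseteq> (?w \<leadsto> k)"
      using residuation w xy mem meet_comm by metis+
    then have "x \<squnion> y \<sqsubseteq> (?w \<leadsto> k)"
      by (simp add: join_least xy w mem imp_closed)
    then have "k \<in> g"
      using xy w mem g by (meson filter_mp filter_up imp_closed)
    then show False using k g by blast
  qed
  moreover have "g \<noteq> carrier A" using g I by blast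
  ultimately have "g \<in> prime_filters A" using g(1) by (simp add: prime_filters_def)
  then show ?thesis using g by blast
qed

text \<open>The form suited to the operators: disjointness of the generated filter from
  \<open>I\<close> is tested on generators. Directed sets are allowed because images under
  \<open>\<diamond>\<close> need not be closed under meets, nor images under \<open>\<box>\<close>
  under joins.\<close>

lemma prime_filter_separation:
  assumes f: "is_filter A f"
    and B: "B \<subseteq> carrier A" "B \<noteq> {}"
    and B_directed: "\<And>b b'. \<lbrakk>b \<in> B; b' \<in> B\<rbrakk> \<Longrightarrow> \<exists>c \<in> B. c \<sqsubseteq> b \<and> c \<sqsubseteq> b'"
    and I: "I \<subseteq> carrier A" "I \<noteq> {}"
    and I_directed: "\<And>i j. \<lbrakk>i \<in> I; j \<in> I\<rbrakk> \<Longrightarrow> \<exists>k \<in> I. i \<sqsubseteq> k \<and> j \<sqsubseteq> k"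
    and disj: "\<And>d b i. \<lbrakk>d \<in> f; b \<in> B; i \<in> I\<rbrakk> \<Longrightarrow> \<not> d \<sqinter> b \<sqsubseteq> i"
  obtains g where "g \<in> prime_filters A" "f \<subseteq> g" "B \<subseteq> g" "g \<inter> I = {}"
proof -
  have "adjoin f B \<inter> I = {}" using disj by (auto simp: adjoin_def)
  then obtain g where "g \<in> prime_filters A" "adjoin f B \<subseteq> g" "g \<inter> I = {}"
    using prime_filter_exists[OF is_filter_adjoin[OF f B B_directed] I I_directed] by blast
  then show ?thesis
    using that adjoin_superset1[OF f B] adjoin_superset2[OF f B(1)] by blast
qed

text \<open>By residuation, the filter generated by \<open>f\<close> and \<open>a\<close> contains
  \<open>b\<close> only if \<open>a \<leadsto> b\<close> is already in \<open>f\<close>.\<close>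

lemma prime_filter_separation_elements:
  assumes f: "is_filter A f" and a: "a \<in> carrier A" and b: "b \<in> carrier A"
    and "a \<leadsto> b \<notin> f"
  obtains g where "g \<in> prime_filters A" "f \<subseteq> g" "a \<in> g" "b \<notin> g"
proof (rule prime_filter_separation[of f "{a}" "{b}"])
  show "\<not> d \<sqinter> x \<sqsubseteq> i" if "d \<in> f" "x \<in> {a}" "i \<in> {b}" for d x i
    using that assms residuation filter_closed filter_up imp_closed by (metis singletonD)
qed (use assms that le_refl in auto)

section \<open>The representation map as a Heyting algebra isomorphism\<close>

lemma r_map_imp:
  assumes a: "a \<in> carrier A" and b: "b \<in> carrier A"
  shows "r_map A (a \<leadsto> b) = prime_filters A - filter_order A `` (r_map A a - r_map A b)"
proof (intro equalityI subsetI)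
  fix f assume "f \<in> r_map A (a \<leadsto> b)"
  then show "f \<in> prime_filters A - filter_order A `` (r_map A a - r_map A b)"
    using filter_mp[OF prime_filter_is_filter _ _ b, of _ a]
    by (auto simp: r_map_def filter_order_def)
next
  fix f assume f: "f \<in> prime_filters A - filter_order A `` (r_map A a - r_map A b)"
  then have "is_filter A f" by (simp add: prime_filter_is_filter)
  have "a \<leadsto> b \<in> f"
  proof (rule ccontr)
    assume "a \<leadsto> b \<notin> f"
    \<comment> \<open>As the order is reverse inclusion, this \<open>g\<close> lies below
      \<open>f\<close> and puts \<open>f\<close> into the upset that was removed.\<close>
    then obtain g where "g \<in> prime_filters A" "f \<subseteq> g" "a \<in> g" "b \<notin> g"
      using prime_filter_separation_elements[OF \<open>is_filter A f\<close> a b] by blast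
    then show False using f by (auto simp: r_map_def filter_order_def)
  qed
  then show "f \<in> r_map A (a \<leadsto> b)" using f by (simp add: r_map_def)
qed

lemma r_map_meet:
  assumes "a \<in> carrier A" "b \<in> carrier A"
  shows "r_map A (a \<sqinter> b) = r_map A a \<inter> r_map A b"
proof -
  have "a \<sqinter> b \<in> f \<longleftrightarrow> a \<in> f \<and> b \<in> f" if "f \<in> prime_filters A" for f
  proof -
    have f: "is_filter A f" using that by (rule prime_filter_is_filter)
    show ?thesis
      using filter_meet[OF f] filter_up[OF f _ meet_le1[OF assms]]
        filter_up[OF f _ meet_le2[OF assms]] assms by blast
  qed
  then show ?thesis by (auto simp: r_map_def)
qed

lemma r_map_join:
  "\<lbrakk>a \<in> carrier A; b \<in> carrier A\<rbrakk> \<Longrightarrow> r_map A (a \<squnion> b) = r_map A a \<union> r_map A b"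
  by (auto simp: r_map_def prime_filter_join)

lemma r_map_bottom: "r_map A \<bottom> = {}"
  by (auto simp: r_map_def prime_filter_bottom)

lemma r_map_top: "r_map A \<top> = prime_filters A"
  by (auto simp: r_map_def filter_top prime_filter_is_filter)

lemma r_map_downset: "r_map A a \<in> downsets (prime_filters A) (filter_order A)"
  by (auto simp: r_map_def downsets_def filter_order_def)

text \<open>Separation over the trivial filter \<open>{\<top>}\<close>: if
  \<open>a \<leadsto> b\<close> were not \<open>\<top>\<close>, some prime filter would contain
  \<open>a\<close> but not \<open>b\<close>. Injectivity of \<open>r_map\<close> follows by
  antisymmetry.\<close>

lemma r_map_subset_imp_le:
  assumes a: "a \<in> carrier A" and b: "b \<in> carrier A" and sub: "r_map A a \<subseteq> r_map A b"
  shows "a \<sqsubseteq> b"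
proof -
  have "a \<leadsto> b = \<top>"
    using prime_filter_separation_elements[OF is_filter_top a b] sub
    unfolding r_map_def by blast
  then have "\<top> \<sqinter> a \<sqsubseteq> b"
    using residuation[OF a b top_closed] by (simp add: le_refl top_closed)
  then show ?thesis
    using top_greatest[OF a] meet_comm[OF a top_closed] by (simp add: le_def)
qed

lemma r_map_inj: "inj_on (r_map A) (carrier A)"
  by (rule inj_onI) (simp add: le_antisym r_map_subset_imp_le)

text \<open>The least element is the meet of all elements; the induction builds lower bounds inside
  \<open>f\<close> for ever larger finite subsets.\<close>

lemma finite_filter_principal:
  assumes f: "is_filter A f" and "finite f"
  obtains m where "m \<in> f" "\<And>x. x \<in> f \<Longrightarrow> m \<sqsubseteq> x"
proof -
  have "\<exists>m \<in> f. \<forall>x \<in> S. m \<sqsubseteq> x" if "finite S" "S \<subseteq> f" for S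
    using that
  proof (induction S)
    case empty
    then show ?case using f by (auto simp: is_filter_def)
  next
    case (insert y S)
    then obtain m where m: "m \<in> f" "\<forall>x \<in> S. m \<sqsubseteq> x" by auto
    have mem: "m \<in> carrier A" "y \<in> carrier A" "S \<subseteq> carrier A"
      using insert m filter_closed[OF f] by auto
    then have "m \<sqinter> y \<sqsubseteq> x" if "x \<in> insert y S" for x
      using that m le_trans[OF meet_le1[of m y], of x] by (auto simp: meet_closed meet_le2)
    then show ?case using filter_meet[OF f] m insert by blast
  qed
  from this[OF assms(2) subset_refl] show ?thesis using that by blast
qed

text \<open>A downset is the union of the principal downsets below its elements, and the downset
  below a prime filter is the image of the least element of that filter.\<close>

lemma r_map_surj:
  assumes fin: "finite (carrier A)" and D: "D \<in> downsets (prime_filters A) (filter_order A)"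
  shows "\<exists>a \<in> carrier A. r_map A a = D"
proof -
  have principal: "\<exists>m \<in> carrier A. r_map A m = {h \<in> prime_filters A. f \<subseteq> h}"
    if "f \<in> prime_filters A" for f
  proof -
    have f: "is_filter A f" using that by (rule prime_filter_is_filter)
    have "finite f" using filter_closed[OF f] by (intro finite_subset[OF _ fin] subsetI)
    then obtain m where m: "m \<in> f" "\<And>x. x \<in> f \<Longrightarrow> m \<sqsubseteq> x"
      using finite_filter_principal[OF f] by blast
    have "f \<subseteq> h" if "h \<in> prime_filters A" "m \<in> h" for h
      using filter_up[OF prime_filter_is_filter[OF that(1)] that(2)] m filter_closed[OF f]
      by blast
    then have "r_map A m = {h \<in> prime_filters A. f \<subseteq> h}"
      using m(1) by (auto simp: r_map_def)
    then show ?thesis using filter_closed[OF f m(1)] by blast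
  qed
  have sub: "D \<subseteq> prime_filters A" using D by (simp add: downsets_def)
  have "finite (prime_filters A)"
    by (rule finite_subset[of _ "Pow (carrier A)"])
      (use fin in \<open>auto simp: prime_filters_def is_filter_def\<close>)
  then have "finite D" using sub finite_subset by blast
  have *: "\<exists>a \<in> carrier A. r_map A a = {h \<in> prime_filters A. \<exists>f \<in> E. f \<subseteq> h}"
    if "finite E" "E \<subseteq> prime_filters A" for E
    using that
  proof (induction E)
    case empty
    then show ?case using bottom_closed r_map_bottom by auto
  next
    case (insert f E)
    obtain a where a: "a \<in> carrier A"
      "r_map A a = {h \<in> prime_filters A. \<exists>f \<in> E. f \<subseteq> h}"
      using insert by blast
    obtain m where m: "m \<in> carrier A" "r_map A m = {h \<in> prime_filters A. f \<subseteq> h}"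
      using principal[of f] insert.prems by blast
    have "r_map A (m \<squnion> a) = {h \<in> prime_filters A. \<exists>f \<in> insert f E. f \<subseteq> h}"
      using a m by (auto simp: r_map_join)
    then show ?case using join_closed[OF m(1) a(1)] by (rule bexI)
  qed
  have "{h \<in> prime_filters A. \<exists>f \<in> D. f \<subseteq> h} = D"
  proof
    show "{h \<in> prime_filters A. \<exists>f \<in> D. f \<subseteq> h} \<subseteq> D"
      using D sub unfolding downsets_def filter_order_def by blast
  qed (use sub in blast)
  with *[OF \<open>finite D\<close> sub] show ?thesis by simp
qed

lemma r_map_bij:
  assumes "finite (carrier A)"
  shows "bij_betw (r_map A) (carrier A) (downsets (prime_filters A) (filter_order A))"
proof (rule bij_betw_imageI[OF r_map_inj])
  show "r_map A ` carrier A = downsets (prime_filters A) (filter_order A)"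
  proof
    show "r_map A ` carrier A \<subseteq> downsets (prime_filters A) (filter_order A)"
      using r_map_downset by (rule image_subsetI)
    show "downsets (prime_filters A) (filter_order A) \<subseteq> r_map A ` carrier A"
    proof
      fix D assume "D \<in> downsets (prime_filters A) (filter_order A)"
      from r_map_surj[OF assms this] obtain a where "a \<in> carrier A" "r_map A a = D"
        by (rule bexE)
      then show "D \<in> r_map A ` carrier A" by (intro image_eqI[of D _ a]) simp_all
    qed
  qed
qed

end

section \<open>Box and diamond on prime filters\<close>

context gao
begin

lemma Box_mono: "\<lbrakk>x \<sqsubseteq> y; x \<in> carrier A; y \<in> carrier A\<rbrakk> \<Longrightarrow> \<box> x \<sqsubseteq> \<box> y"
  unfolding le_def by (metis Box_meet)

lemma Dia_mono: "\<lbrakk>x \<sqsubseteq> y; x \<in> carrier A; y \<in> carrier A\<rbrakk> \<Longrightarrow> \<diamond> x \<sqsubseteq> \<diamond> y"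
  by (metis Dia_join Dia_closed le_iff_join)

text \<open>This filter is the starting point for both operators: a prime filter contains it exactly
  when it is an \<open>R_Box\<close> successor of \<open>f\<close>, for prime
  \<open>f\<close>.\<close>

lemma is_filter_Box_vimage:
  assumes f: "is_filter A f"
  shows "is_filter A {x \<in> carrier A. \<box> x \<in> f}"
proof -
  have "\<top> \<in> {x \<in> carrier A. \<box> x \<in> f}"
    using filter_top[OF f] by (simp add: top_closed Box_top)
  then show ?thesis
    using filter_meet[OF f] filter_up[OF f] Box_mono Box_closed
    unfolding is_filter_def by (auto simp: Box_meet meet_closed)
qed

end

context fischer_servi_gao
begin

lemma r_map_Dia:
  assumes a: "a \<in> carrier A"
  shows "r_map A (\<diamond> a) = delta (prime_filters A) (R_rel A) (r_map A a)"
proof (intro equalityI subsetI)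
  fix f assume "f \<in> delta (prime_filters A) (R_rel A) (r_map A a)"
  then show "f \<in> r_map A (\<diamond> a)"
    by (auto simp: delta_def R_rel_def R_Dia_def r_map_def)
next
  fix f assume "f \<in> r_map A (\<diamond> a)"
  then have fp: "f \<in> prime_filters A" and af: "\<diamond> a \<in> f" by (auto simp: r_map_def)
  then have f: "is_filter A f" by (simp add: prime_filter_is_filter)
  \<comment> \<open>Missing \<open>?I\<close> gives \<open>g\<close> the \<open>R_Dia\<close> half
    of the relation; containing the inverse image of \<open>f\<close> under \<open>\<box>\<close>
    gives the \<open>R_Box\<close> half.\<close>
  let ?I = "{c \<in> carrier A. \<diamond> c \<notin> f}"
  obtain g where g: "g \<in> prime_filters A" "{x \<in> carrier A. \<box> x \<in> f} \<subseteq> g" "{a} \<subseteq> g" "g \<inter> ?I = {}"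
  proof (rule prime_filter_separation[OF is_filter_Box_vimage[OF f], of "{a}" ?I])
    show "?I \<noteq> {}" using prime_filter_bottom[OF fp] bottom_closed Dia_bottom by force
  next
    fix i j assume ij: "i \<in> ?I" "j \<in> ?I"
    then have "i \<squnion> j \<in> ?I"
      using prime_filter_join[OF fp] by (auto simp: join_closed Dia_join Dia_closed)
    then show "\<exists>k \<in> ?I. i \<sqsubseteq> k \<and> j \<sqsubseteq> k" using ij join_ge1 join_ge2 by blast
  next
    fix d b i assume "d \<in> {x \<in> carrier A. \<box> x \<in> f}" "b \<in> {a}" and i: "i \<in> ?I"
    then have d: "d \<in> carrier A" "\<box> d \<in> f" "b = a" by auto
    show "\<not> d \<sqinter> b \<sqsubseteq> i"
    proof
      assume "d \<sqinter> b \<sqsubseteq> i"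
      \<comment> \<open>Moving \<open>d\<close> across lets \<open>\<diamond>\<close> act on the
        implication, so that \<open>FS1\<close> applies. With \<open>\<box> d \<in> f\<close> this
        forces \<open>\<diamond> i \<in> f\<close>, contrary to \<open>i \<in> ?I\<close>.\<close>
      then have "a \<sqsubseteq> (d \<leadsto> i)"
        using residuation[of d i a] meet_comm[of d a] d a i by auto
      then have "\<diamond> a \<sqsubseteq> \<diamond> (d \<leadsto> i)"
        using Dia_mono a d i imp_closed by auto
      then have "\<diamond> (d \<leadsto> i) \<in> f"
        using filter_up[OF f af] d i imp_closed Dia_closed by auto
      then have "\<box> d \<leadsto> \<diamond> i \<in> f"
        using filter_up[OF f _ FS1] d i imp_closed Dia_closed Box_closed by auto
      then show False using filter_mp[OF f] d i Dia_closed by auto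
    qed
  qed (use a le_refl in auto)
  then have "(f, g) \<in> R_rel A"
    using fp filter_closed[OF prime_filter_is_filter] by (auto simp: R_rel_def R_Box_def R_Dia_def)
  then show "f \<in> delta (prime_filters A) (R_rel A) (r_map A a)"
    using g fp by (auto simp: delta_def r_map_def)
qed

text \<open>This is why the box relation is composed with \<open>\<ge>\<close>. An
  \<open>R_Box\<close> successor \<open>g\<close> of \<open>f\<close> may fail to be an
  \<open>R_Dia\<close> successor, since \<open>\<diamond> x\<close> for \<open>x \<in> g\<close> can
  lie outside \<open>f\<close>. Enlarging \<open>f\<close> to \<open>h\<close> adds these elements,
  and avoiding every \<open>\<box> c\<close> with \<open>c \<notin> g\<close> preserves the
  \<open>R_Box\<close> half.\<close>

lemma R_rel_lift:
  assumes fp: "f \<in> prime_filters A" and gp: "g \<in> prime_filters A"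
    and sub: "{x \<in> carrier A. \<box> x \<in> f} \<subseteq> g"
  obtains h where "(h, f) \<in> filter_order A" "(h, g) \<in> R_rel A"
proof -
  have f: "is_filter A f" and g: "is_filter A g" using fp gp by (auto simp: prime_filter_is_filter)
  note gc = filter_closed[OF g]
  let ?B = "Dia A ` g" and ?I = "Box A ` (carrier A - g)"
  obtain h where h: "h \<in> prime_filters A" "f \<subseteq> h" "?B \<subseteq> h" "h \<inter> ?I = {}"
  proof (rule prime_filter_separation[OF f, of ?B ?I])
    show "?B \<subseteq> carrier A" "?I \<subseteq> carrier A" using gc Dia_closed Box_closed by auto
    show "?B \<noteq> {}" using filter_top[OF g] by blast
    show "?I \<noteq> {}" using prime_filter_bottom[OF gp] bottom_closed by blast
  next
    fix b b' assume "b \<in> ?B" "b' \<in> ?B"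
    then obtain x y where xy: "x \<in> g" "y \<in> g" "b = \<diamond> x" "b' = \<diamond> y" by blast
    \<comment> \<open>Monotonicity of \<open>\<diamond>\<close> gives a common lower bound inside
      \<open>?B\<close>, though it may lie strictly below \<open>b \<sqinter> b'\<close>. The
      argument for \<open>?I\<close> is dual.\<close>
    then have "\<diamond> (x \<sqinter> y) \<sqsubseteq> b" "\<diamond> (x \<sqinter> y) \<sqsubseteq> b'"
      using gc by (auto intro!: Dia_mono meet_le1 meet_le2 meet_closed)
    then show "\<exists>c \<in> ?B. c \<sqsubseteq> b \<and> c \<sqsubseteq> b'" using filter_meet[OF g] xy by blast
  next
    fix i j assume "i \<in> ?I" "j \<in> ?I"
    then obtain x y where xy: "x \<in> carrier A - g" "y \<in> carrier A - g" "i = \<box> x" "j = \<box> y" by blast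
    then have "i \<sqsubseteq> \<box> (x \<squnion> y)" "j \<sqsubseteq> \<box> (x \<squnion> y)"
      by (auto intro!: Box_mono join_ge1 join_ge2 join_closed)
    moreover have "x \<squnion> y \<in> carrier A - g"
      using xy prime_filter_join[OF gp] by (auto simp: join_closed)
    ultimately show "\<exists>k \<in> ?I. i \<sqsubseteq> k \<and> j \<sqsubseteq> k" by blast
  next
    fix d b i assume d: "d \<in> f" and "b \<in> ?B" "i \<in> ?I"
    then obtain x y where xy: "x \<in> g" "b = \<diamond> x" "y \<in> carrier A" "y \<notin> g" "i = \<box> y" by blast
    have mem: "x \<in> carrier A" "d \<in> carrier A" using xy gc d filter_closed[OF f] by auto
    show "\<not> d \<sqinter> b \<sqsubseteq> i"
    proof
      assume "d \<sqinter> b \<sqsubseteq> i"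
      \<comment> \<open>This puts the premise of \<open>FS2\<close> into \<open>f\<close>. Then
        \<open>x \<leadsto> y\<close> lies in \<open>g\<close> by \<open>sub\<close>, and
        \<open>x \<in> g\<close> forces \<open>y \<in> g\<close>, a contradiction.\<close>
      then have "d \<sqsubseteq> (\<diamond> x \<leadsto> \<box> y)"
        using residuation[of "\<diamond> x" "\<box> y" d] xy mem Dia_closed Box_closed by auto
      then have "\<diamond> x \<leadsto> \<box> y \<in> f"
        using filter_up[OF f d] xy mem Dia_closed Box_closed imp_closed by auto
      then have "\<box> (x \<leadsto> y) \<in> f"
        using filter_up[OF f _ FS2] xy mem Box_closed imp_closed by auto
      then have "x \<leadsto> y \<in> g" using sub xy mem imp_closed by auto
      then show False using filter_mp[OF g] xy by auto
    qed
  qed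
  have "(h, g) \<in> R_rel A"
    using h gp gc by (auto simp: R_rel_def R_Box_def R_Dia_def)
  then show ?thesis using that h fp by (auto simp: filter_order_def)
qed

text \<open>From left to right, \<open>\<box> a\<close> passes from \<open>f\<close> to any larger
  \<open>h\<close>, and then \<open>a\<close> passes to every \<open>R_Box\<close> successor of
  \<open>h\<close>. Conversely, if \<open>\<box> a \<notin> f\<close>, some prime
  \<open>R_Box\<close> successor of \<open>f\<close> omits \<open>a\<close>, and
  \<open>R_rel_lift\<close> makes it reachable in two steps.\<close>

lemma r_map_Box:
  assumes a: "a \<in> carrier A"
  shows "r_map A (\<box> a) = beta (prime_filters A) ((filter_order A)\<inverse> O R_rel A) (r_map A a)"
proof (intro equalityI subsetI)
  fix f assume "f \<in> r_map A (\<box> a)"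
  then show "f \<in> beta (prime_filters A) ((filter_order A)\<inverse> O R_rel A) (r_map A a)"
    using a by (auto simp: beta_def R_rel_def R_Box_def r_map_def filter_order_def)
next
  fix f assume fb: "f \<in> beta (prime_filters A) ((filter_order A)\<inverse> O R_rel A) (r_map A a)"
  then have fp: "f \<in> prime_filters A" by (simp add: beta_def)
  then have f: "is_filter A f" by (simp add: prime_filter_is_filter)
  have "\<box> a \<in> f"
  proof (rule ccontr)
    assume "\<box> a \<notin> f"
    then have "{x \<in> carrier A. \<box> x \<in> f} \<inter> {a} = {}" by auto
    then obtain g where g: "g \<in> prime_filters A" "{x \<in> carrier A. \<box> x \<in> f} \<subseteq> g" "a \<notin> g"
      using prime_filter_exists[OF is_filter_Box_vimage[OF f], of "{a}"] a le_refl by auto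
    obtain h where "(h, f) \<in> filter_order A" "(h, g) \<in> R_rel A"
      using R_rel_lift[OF fp g(1,2)] .
    then show False using fb g by (auto simp: beta_def r_map_def)
  qed
  then show "f \<in> r_map A (\<box> a)" using fp by (simp add: r_map_def)
qed

end

theorem theorem5p6:
  fixes A :: "('a, 'm) gao_scheme"
  assumes "fischer_servi_gao A" and "finite (carrier A)"
  shows "gao_iso (r_map A) A
    (with_operators (downset_algebra (prime_filters A) (filter_order A))
       (beta (prime_filters A) ((filter_order A)\<inverse> O R_rel A))
       (delta (prime_filters A) (R_rel A)))"
proof -
  interpret fischer_servi_gao A by (rule assms(1))
  show ?thesis
    \<comment> \<open>With the records unfolded, each conjunct is one of the \<open>r_map\<close>
      lemmas; finiteness enters through surjectivity in \<open>r_map_bij\<close>.\<close>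
    unfolding gao_iso_def with_operators_def downset_algebra_def heyting.defs gao.defs
    using assms(2)
    by (simp add: r_map_bij r_map_meet r_map_join r_map_imp r_map_bottom r_map_top
        r_map_Box r_map_Dia)
qed

end
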